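(* If $X$ is a generalized metric space then its Isbell completion $I(X)$ is categorically complete and hence can be equipped with a metric semi-tropical module structure.
   Context: A generalized metric space is a set $X$ with $d_X\colon X\times X\to[0,\infty]$ such that $d_X(x,x)=0$ and $d_X(x,y)+d_X(y,z)\ge d_X(x,z)$ for all $x,y,z\in X$ (no symmetry, separation or finiteness). For $a,b\in[0,\infty]$ write $b\dot{-}a:=\max(b-a,0)$ (with $\infty\dot{-}\infty=0$); $[0,\infty]$ is a generalized metric space with $d(a,b)=b\dot{-}a$. $X^{\mathrm{op}}$ has the same points and reversed metric. A short map $F\colon X\to Y$ is a function with $d_X(x,x')\ge d_Y(F(x),F(x'))$. $\widehat X$ is the space of presheaves, i.e. short maps $f\colon X^{\mathrm{op}}\to[0,\infty]$, with metric $d_{\widehat X}(f,f')=\sup_x(f'(x)\dot{-}f(x))$; $\check X$ is the space of co-presheaves, i.e. short maps $g\colon X\to[0,\infty]$, with metric $\sup_x(g'(x)\dot{-}g(x))$. Define $L(f)(y)=\sup_{x}(d_X(x,y)\dot{-}f(x))$ for $f\in\widehat X$ and $R(g)(x)=\sup_y(d_X(x,y)\dot{-}g(y))$ for $g\in\check X^{\mathrm{op}}$. The Isbell completion is $I(X)=\{(f,g)\in\widehat X\times\check X^{\mathrm{op}}\mid L(f)=g,\ R(g)=f\}$ with metric $d_{I(X)}((f,g),(f',g'))=\max\{d_{\widehat X}(f,f'),\,d_{\check X^{\mathrm{op}}}(g,g')\}$. For a generalized metric space $Z$, a short map $J\colon D\to Z$ from a generalized metric space $D$, and a short map $W\colon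 D\to[0,\infty]$, a limit of $J$ weighted by $W$ is a point $l\in Z$ with $d_Z(z,l)=\sup_{e\in D}(d_Z(z,J(e))\dot{-}W(e))$ for all $z\in Z$. $Z$ is categorically complete if such limits exist for all $D,J,W$. The semi-tropical semiring is $([0,\infty],\min,+)$ (additive unit $\infty$, multiplicative unit $0$). A semi-tropical module is a commutative monoid $(M,\boxplus,\mathbf 0)$ with an action $\boxdot\colon[0,\infty]\times M\to M$ such that $r\mapsto r\boxdot(-)$ is a unital semiring morphism to the semiring $(\operatorname{End}(M),\boxplus,\circ)$ of monoid endomorphisms of $M$ (preserving addition, multiplication and both units). Morphisms are monoid maps preserving the action. $([0,\infty],\max)$ is a semi-tropical module via $(r,m)\mapsto m\dot{-}r$. A metric semi-tropical module structure on a generalized metric space $(M,d)$ is a semi-tropical module structure on $M$ such that for every $x\in M$ the map $d(x,-)\colon M\to([0,\infty],\max)$ is a morphism of semi-tropical modules. *)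

theory Defs
  imports "HOL-Library.Extended_Nonnegative_Real" "HOL-Library.FuncSet" "HOL-Algebra.Group"
begin

(* The minus of ennreal satisfies infinity - infinity = infinity, so truncated subtraction is defined separately. *)
definition tsub :: "ennreal \<Rightarrow> ennreal \<Rightarrow> ennreal"  (infixl "-\<^sub>t" 65)
  where "b -\<^sub>t a = (if b \<le> a then 0 else b - a)"

locale gen_metric_space =
  fixes X :: "'a set" and d :: "'a \<Rightarrow> 'a \<Rightarrow> ennreal"
  assumes dist_self: "x \<in> X \<Longrightarrow> d x x = 0"
    and triangle: "\<lbrakk>x \<in> X; y \<in> X; z \<in> X\<rbrakk> \<Longrightarrow> d x z \<le> d x y + d y z"

definition ennreal_dist :: "ennreal \<Rightarrow> ennreal \<Rightarrow> ennreal"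
  where "ennreal_dist a b = b -\<^sub>t a"

definition op_dist :: "('a \<Rightarrow> 'a \<Rightarrow> ennreal) \<Rightarrow> 'a \<Rightarrow> 'a \<Rightarrow> ennreal"
  where "op_dist d x y = d y x"

definition short_map ::
  "'a set \<Rightarrow> ('a \<Rightarrow> 'a \<Rightarrow> ennreal) \<Rightarrow> 'b set \<Rightarrow> ('b \<Rightarrow> 'b \<Rightarrow> ennreal) \<Rightarrow> ('a \<Rightarrow> 'b) \<Rightarrow> bool"
  where "short_map X dX Y dY F \<longleftrightarrow>
    F \<in> X \<rightarrow> Y \<and> (\<forall>x\<in>X. \<forall>x'\<in>X. dX x x' \<ge> dY (F x) (F x'))"

(* Functions on the carrier X are represented by their extensional representatives
   (value undefined outside X), so that HOL equality is equality of functions on X. *)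
definition presheaves :: "'a set \<Rightarrow> ('a \<Rightarrow> 'a \<Rightarrow> ennreal) \<Rightarrow> ('a \<Rightarrow> ennreal) set"
  where "presheaves X d = {f \<in> extensional X. short_map X (op_dist d) UNIV ennreal_dist f}"

definition copresheaves :: "'a set \<Rightarrow> ('a \<Rightarrow> 'a \<Rightarrow> ennreal) \<Rightarrow> ('a \<Rightarrow> ennreal) set"
  where "copresheaves X d = {g \<in> extensional X. short_map X d UNIV ennreal_dist g}"

(* The metric of both presheaves X d and copresheaves X d. *)
definition sup_dist :: "'a set \<Rightarrow> ('a \<Rightarrow> ennreal) \<Rightarrow> ('a \<Rightarrow> ennreal) \<Rightarrow> ennreal"
  where "sup_dist X f f' = (SUP x\<in>X. f' x -\<^sub>t f x)"

definition isbell_L :: "'a set \<Rightarrow> ('a \<Rightarrow> 'a \<Rightarrow> ennreal) \<Rightarrow> ('a \<Rightarrow> ennreal) \<Rightarrow> 'a \<Rightarrow> ennreal"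
  where "isbell_L X d f = (\<lambda>y\<in>X. SUP x\<in>X. d x y -\<^sub>t f x)"

definition isbell_R :: "'a set \<Rightarrow> ('a \<Rightarrow> 'a \<Rightarrow> ennreal) \<Rightarrow> ('a \<Rightarrow> ennreal) \<Rightarrow> 'a \<Rightarrow> ennreal"
  where "isbell_R X d g = (\<lambda>x\<in>X. SUP y\<in>X. d x y -\<^sub>t g y)"

definition isbell :: "'a set \<Rightarrow> ('a \<Rightarrow> 'a \<Rightarrow> ennreal) \<Rightarrow> (('a \<Rightarrow> ennreal) \<times> ('a \<Rightarrow> ennreal)) set"
  where "isbell X d = {(f, g) \<in> presheaves X d \<times> copresheaves X d.
    isbell_L X d f = g \<and> isbell_R X d g = f}"

definition isbell_dist ::
  "'a set \<Rightarrow> ('a \<Rightarrow> ennreal) \<times> ('a \<Rightarrow> ennreal) \<Rightarrow> ('a \<Rightarrow> ennreal) \<times> ('a \<Rightarrow> ennreal) \<Rightarrow> ennreal"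
  where "isbell_dist X p q =
    max (sup_dist X (fst p) (fst q)) (op_dist (sup_dist X) (snd p) (snd q))"

definition weighted_limit ::
  "'z set \<Rightarrow> ('z \<Rightarrow> 'z \<Rightarrow> ennreal) \<Rightarrow> 'e set \<Rightarrow> ('e \<Rightarrow> 'z) \<Rightarrow> ('e \<Rightarrow> ennreal) \<Rightarrow> 'z \<Rightarrow> bool"
  where "weighted_limit Z dZ D J W l \<longleftrightarrow>
    l \<in> Z \<and> (\<forall>z\<in>Z. dZ z l = (SUP e\<in>D. dZ z (J e) -\<^sub>t W e))"

(* A formula cannot quantify over types, so the type of the points of the indexing spaces D is
   passed as an argument; leaving it as a type variable in a theorem ranges over all D. *)
definition categorically_complete ::
  "'e itself \<Rightarrow> 'z set \<Rightarrow> ('z \<Rightarrow> 'z \<Rightarrow> ennreal) \<Rightarrow> bool"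
  where "categorically_complete (_ :: 'e itself) Z dZ \<longleftrightarrow>
    gen_metric_space Z dZ \<and>
    (\<forall>(D :: 'e set) dD J W.
      gen_metric_space D dD \<longrightarrow> short_map D dD Z dZ J \<longrightarrow>
      short_map D dD UNIV ennreal_dist W \<longrightarrow>
      (\<exists>l. weighted_limit Z dZ D J W l))"

definition monoid_endo :: "('a, 'b) monoid_scheme \<Rightarrow> ('a \<Rightarrow> 'a) \<Rightarrow> bool"
  where "monoid_endo M h \<longleftrightarrow> h \<in> hom M M \<and> h \<one>\<^bsub>M\<^esub> = \<one>\<^bsub>M\<^esub>"

(* The monoid operation of M is the addition of the module and its unit the zero.  The scalars are
   the semiring (ennreal, min, +), whose zero is infinity and whose one is 0; the last four axioms say
   that act is a unital semiring morphism into the endomorphisms of M with pointwise addition and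
   composition. *)
locale semitropical_module = comm_monoid M
  for M :: "('a, 'b) monoid_scheme" (structure) and act :: "ennreal \<Rightarrow> 'a \<Rightarrow> 'a" +
  assumes act_endo: "monoid_endo M (act r)"
    and act_min: "m \<in> carrier M \<Longrightarrow> act (min r s) m = act r m \<otimes> act s m"
    and act_top: "m \<in> carrier M \<Longrightarrow> act \<infinity> m = \<one>"
    and act_plus: "m \<in> carrier M \<Longrightarrow> act (r + s) m = act r (act s m)"
    and act_zero: "m \<in> carrier M \<Longrightarrow> act 0 m = m"

definition semitropical_hom ::
  "('a, 'c) monoid_scheme \<Rightarrow> (ennreal \<Rightarrow> 'a \<Rightarrow> 'a) \<Rightarrow>
   ('b, 'd) monoid_scheme \<Rightarrow> (ennreal \<Rightarrow> 'b \<Rightarrow> 'b) \<Rightarrow> ('a \<Rightarrow> 'b) \<Rightarrow> bool"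
  where "semitropical_hom M actM N actN h \<longleftrightarrow>
    h \<in> hom M N \<and> h \<one>\<^bsub>M\<^esub> = \<one>\<^bsub>N\<^esub> \<and>
    (\<forall>r. \<forall>m\<in>carrier M. h (actM r m) = actN r (h m))"

definition max_monoid :: "ennreal monoid"
  where "max_monoid = \<lparr>carrier = UNIV, mult = max, one = 0\<rparr>"

definition max_act :: "ennreal \<Rightarrow> ennreal \<Rightarrow> ennreal"
  where "max_act r m = m -\<^sub>t r"

lemma tsub_le_iff: "b -\<^sub>t a \<le> c \<longleftrightarrow> b \<le> a + c"
proof (cases "b \<le> a")
  case True
  then show ?thesis
    by (simp add: tsub_def add_increasing2)
next
  case False
  then show ?thesis
    by (cases a; cases b; cases c)
      (auto simp: tsub_def infinity_ennreal_def ennreal_minus ennreal_plus[symmetric] top_unique simp del: ennreal_plus)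
qed

lemma ennreal_eqI: "(\<And>c. x \<le> c \<longleftrightarrow> y \<le> c) \<Longrightarrow> x = y" for x y :: ennreal
  by (meson order.antisym order_refl)

lemma tsub_max: "max a b -\<^sub>t r = max (a -\<^sub>t r) (b -\<^sub>t r)"
  by (rule ennreal_eqI) (simp add: tsub_le_iff)

lemma tsub_min: "m -\<^sub>t min r s = max (m -\<^sub>t r) (m -\<^sub>t s)"
proof (rule ennreal_eqI)
  fix c
  have "m \<le> min r s + c \<longleftrightarrow> m \<le> r + c \<and> m \<le> s + c"
  proof (cases "r \<le> s")
    case True
    then show ?thesis
      using add_right_mono[of r s c] by (auto simp: min_def intro: order_trans)
  next
    case False
    then have "s \<le> r" by simp
    then show ?thesis
      using add_right_mono[of s r c] by (auto simp: min_def intro: order_trans)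
  qed
  then show "m -\<^sub>t min r s \<le> c \<longleftrightarrow> max (m -\<^sub>t r) (m -\<^sub>t s) \<le> c"
    by (simp add: tsub_le_iff)
qed

lemma semitropical_module_max: "semitropical_module max_monoid max_act"
proof -
  interpret comm_monoid max_monoid
    by unfold_locales (auto simp: max_monoid_def ac_simps)
  show ?thesis
  proof
    fix r s m
    show "monoid_endo max_monoid (max_act r)"
      by (auto simp: monoid_endo_def hom_def max_monoid_def max_act_def tsub_max)
         (simp add: tsub_def)
    show "max_act (min r s) m = max_act r m \<otimes>\<^bsub>max_monoid\<^esub> max_act s m"
      by (simp add: max_act_def max_monoid_def tsub_min)
    show "max_act \<infinity> m = \<one>\<^bsub>max_monoid\<^esub>"
      by (simp add: max_act_def max_monoid_def tsub_def infinity_ennreal_def)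
    show "max_act (r + s) m = max_act r (max_act s m)"
      unfolding max_act_def by (rule ennreal_eqI) (simp add: tsub_le_iff ac_simps)
    show "max_act 0 m = m"
      by (simp add: max_act_def tsub_def)
  qed
qed

locale metric_semitropical_module =
  gen_metric_space "carrier M" d + semitropical_module M act
  for M :: "('a, 'b) monoid_scheme" (structure)
    and act :: "ennreal \<Rightarrow> 'a \<Rightarrow> 'a" and d :: "'a \<Rightarrow> 'a \<Rightarrow> ennreal" +
  assumes dist_hom: "x \<in> carrier M \<Longrightarrow> semitropical_hom M act max_monoid max_act (d x)"

end

theory Submission
  imports Defs
begin

text \<open>
  The idea is that a point of \<open>I(X)\<close> is determined by its presheaf component, and that limits in
  \<open>I(X)\<close> are computed on presheaf components.

  For Isbell points the two terms of the metric agree, because both are at most \<open>c\<close> exactly when the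
  presheaf components satisfy \<open>f' \<le> f + c\<close> (lemma \<open>isbell_dist_le_iff\<close>).  Hence the limit of points
  \<open>(f\<^sub>e, g\<^sub>e)\<close> weighted by \<open>W\<close> must have the presheaf component \<open>sup\<^sub>e (f\<^sub>e - W e)\<close>.  This supremum
  is again a value of \<open>R\<close>: as \<open>f\<^sub>e = R g\<^sub>e\<close> and truncated subtraction turns infima of the subtrahend
  into suprema, it equals \<open>R (inf\<^sub>e (g\<^sub>e + W e))\<close>.  Since \<open>L\<close> and \<open>R\<close> form a Galois connection, every
  value of \<open>R\<close> is the presheaf component of an Isbell point, and so the limit exists.

  The passage to modules is a Yoneda argument valid for every separated complete space \<open>Z\<close>.  Limits
  over the empty set, a point and a discrete pair provide a zero, an action and an addition which
  every \<open>d(z,-)\<close> carries to those of \<open>([0,\<infinity>], max)\<close>.  In a separated space a point \<open>y\<close> is determined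
  by the function \<open>z \<mapsto> d(z,y)\<close>, so each module law for \<open>Z\<close> follows from the same law for
  \<open>([0,\<infinity>], max)\<close>.
\<close>

section \<open>Truncated subtraction\<close>

lemma tsub_0: "b -\<^sub>t 0 = b"
  by (simp add: tsub_def)

lemma tsub_tsub: "a -\<^sub>t b -\<^sub>t c = a -\<^sub>t (b + c)"
  by (rule ennreal_eqI) (simp add: tsub_le_iff ac_simps)

lemma SUP_tsub: "(SUP i\<in>I. f i) -\<^sub>t c = (SUP i\<in>I. f i -\<^sub>t c)"
  by (rule ennreal_eqI) (simp add: tsub_le_iff SUP_le_iff)

text \<open>
  The bound \<open>a - h \<le> c\<close> is symmetric in \<open>h\<close> and \<open>c\<close>, so it can be read as a lower bound on \<open>h\<close>, and
  such a bound passes to an infimum, also to an empty one.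
\<close>

lemma tsub_INF: "a -\<^sub>t (INF i\<in>I. h i) = (SUP i\<in>I. a -\<^sub>t h i)"
proof (rule ennreal_eqI)
  fix c
  have swap: "a -\<^sub>t b \<le> c \<longleftrightarrow> a -\<^sub>t c \<le> b" for b
    by (simp add: tsub_le_iff add.commute)
  show "a -\<^sub>t (INF i\<in>I. h i) \<le> c \<longleftrightarrow> (SUP i\<in>I. a -\<^sub>t h i) \<le> c"
    unfolding SUP_le_iff swap le_INF_iff ..
qed

section \<open>The Isbell adjunction\<close>

lemma isbell_L_le_iff:
  "y \<in> X \<Longrightarrow> isbell_L X d f y \<le> c \<longleftrightarrow> (\<forall>x\<in>X. d x y \<le> f x + c)"
  by (simp add: isbell_L_def SUP_le_iff tsub_le_iff)

lemma isbell_R_le_iff: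
  "x \<in> X \<Longrightarrow> isbell_R X d g x \<le> c \<longleftrightarrow> (\<forall>y\<in>X. d x y \<le> g y + c)"
  by (simp add: isbell_R_def SUP_le_iff tsub_le_iff)

lemma dist_le_isbell_L: "\<lbrakk>x \<in> X; y \<in> X\<rbrakk> \<Longrightarrow> d x y \<le> f x + isbell_L X d f y"
  using isbell_L_le_iff[of y X d f "isbell_L X d f y"] by simp

lemma dist_le_isbell_R: "\<lbrakk>x \<in> X; y \<in> X\<rbrakk> \<Longrightarrow> d x y \<le> g y + isbell_R X d g x"
  using isbell_R_le_iff[of x X d g "isbell_R X d g x"] by simp

text \<open>
  Both \<open>L f \<le> g\<close> and \<open>R g \<le> f\<close> mean that \<open>d x y \<le> f x + g y\<close> for all \<open>x\<close> and \<open>y\<close>.  The lemma is the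
  resulting triangle identity of this Galois connection.
\<close>

lemma isbell_R_L_R: "isbell_R X d (isbell_L X d (isbell_R X d g)) = isbell_R X d g"
proof (rule extensionalityI[of _ X])
  fix x assume x: "x \<in> X"
  have LR_le: "isbell_L X d (isbell_R X d g) y \<le> g y" if "y \<in> X" for y
    using that by (simp add: isbell_L_le_iff dist_le_isbell_R add.commute)
  show "isbell_R X d (isbell_L X d (isbell_R X d g)) x = isbell_R X d g x"
  proof (rule antisym)
    show "isbell_R X d (isbell_L X d (isbell_R X d g)) x \<le> isbell_R X d g x"
      using x by (simp add: isbell_R_le_iff dist_le_isbell_L add.commute)
    show "isbell_R X d g x \<le> isbell_R X d (isbell_L X d (isbell_R X d g)) x"
      unfolding isbell_R_le_iff[OF x]
    proof
      fix y assume y: "y \<in> X"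
      let ?g' = "isbell_L X d (isbell_R X d g)"
      have "d x y \<le> ?g' y + isbell_R X d ?g' x"
        using x y by (rule dist_le_isbell_R)
      also have "\<dots> \<le> g y + isbell_R X d ?g' x"
        using LR_le[OF y] by (rule add_right_mono)
      finally show "d x y \<le> g y + isbell_R X d ?g' x" .
    qed
  qed
qed (simp_all add: isbell_R_def)

context gen_metric_space
begin

lemma isbell_R_presheaf: "isbell_R X d g \<in> presheaves X d"
proof -
  have "isbell_R X d g x' \<le> isbell_R X d g x + d x' x" if "x \<in> X" "x' \<in> X" for x x'
    unfolding isbell_R_le_iff[OF that(2)]
  proof
    fix y assume y: "y \<in> X"
    have "d x' y \<le> d x' x + d x y"
      using that y by (intro triangle)
    also have "\<dots> \<le> d x' x + (g y + isbell_R X d g x)"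
      using that y by (intro add_left_mono dist_le_isbell_R)
    finally show "d x' y \<le> g y + (isbell_R X d g x + d x' x)"
      by (simp add: ac_simps)
  qed
  then show ?thesis
    by (auto simp: presheaves_def short_map_def ennreal_dist_def op_dist_def tsub_le_iff isbell_R_def)
qed

lemma isbell_L_copresheaf: "isbell_L X d f \<in> copresheaves X d"
proof -
  have "isbell_L X d f y' \<le> isbell_L X d f y + d y y'" if "y \<in> X" "y' \<in> X" for y y'
    unfolding isbell_L_le_iff[OF that(2)]
  proof
    fix x assume x: "x \<in> X"
    have "d x y' \<le> d x y + d y y'"
      using that x by (intro triangle)
    also have "\<dots> \<le> (f x + isbell_L X d f y) + d y y'"
      using that x by (intro add_right_mono dist_le_isbell_L)
    finally show "d x y' \<le> f x + (isbell_L X d f y + d y y')"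
      by (simp add: ac_simps)
  qed
  then show ?thesis
    by (auto simp: copresheaves_def short_map_def ennreal_dist_def tsub_le_iff isbell_L_def)
qed

lemma isbell_point_of_R: "(isbell_R X d g, isbell_L X d (isbell_R X d g)) \<in> isbell X d"
  by (simp add: isbell_def isbell_R_presheaf isbell_L_copresheaf isbell_R_L_R)

end

section \<open>The metric of the Isbell completion\<close>

lemma isbell_L_fst: "p \<in> isbell X d \<Longrightarrow> isbell_L X d (fst p) = snd p"
  and isbell_R_snd: "p \<in> isbell X d \<Longrightarrow> isbell_R X d (snd p) = fst p"
  by (auto simp: isbell_def)

text \<open>
  A bound on the presheaf components gives the same bound on the copresheaf components: if
  \<open>f' \<le> f + c\<close>, then every \<open>d x y\<close> is at most \<open>f' x + g' y \<le> f x + (g' y + c)\<close>, which says that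
  \<open>g = L f \<le> g' + c\<close>.
\<close>

lemma isbell_dist_le_iff:
  assumes p: "p \<in> isbell X d" and q: "q \<in> isbell X d"
  shows "isbell_dist X p q \<le> c \<longleftrightarrow> (\<forall>x\<in>X. fst q x \<le> fst p x + c)"
proof -
  have "snd p y \<le> snd q y + c" if le: "\<forall>x\<in>X. fst q x \<le> fst p x + c" and y: "y \<in> X" for y
    unfolding isbell_L_fst[OF p, symmetric] isbell_L_le_iff[OF y]
  proof
    fix x assume x: "x \<in> X"
    have "d x y \<le> fst q x + snd q y"
      using dist_le_isbell_L[OF x y, of d "fst q"] by (simp add: isbell_L_fst[OF q])
    also have "\<dots> \<le> (fst p x + c) + snd q y"
      using le x by (intro add_right_mono) simp
    finally show "d x y \<le> fst p x + (snd q y + c)"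
      by (simp add: ac_simps)
  qed
  then show ?thesis
    by (auto simp: isbell_dist_def op_dist_def sup_dist_def SUP_le_iff tsub_le_iff)
qed

lemma gen_metric_space_isbell: "gen_metric_space (isbell X d) (isbell_dist X)"
proof
  fix p assume p: "p \<in> isbell X d"
  have "isbell_dist X p p \<le> 0"
    unfolding isbell_dist_le_iff[OF p p] by simp
  then show "isbell_dist X p p = 0"
    by simp
next
  fix p q r assume pqr: "p \<in> isbell X d" "q \<in> isbell X d" "r \<in> isbell X d"
  have "fst r x \<le> fst p x + (isbell_dist X p q + isbell_dist X q r)" if x: "x \<in> X" for x
  proof -
    have "fst r x \<le> fst q x + isbell_dist X q r"
      using isbell_dist_le_iff[OF pqr(2,3), of "isbell_dist X q r"] x by simp
    also have "\<dots> \<le> (fst p x + isbell_dist X p q) + isbell_dist X q r"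
      using isbell_dist_le_iff[OF pqr(1,2), of "isbell_dist X p q"] x
      by (intro add_right_mono) simp
    finally show ?thesis
      by (simp add: ac_simps)
  qed
  then show "isbell_dist X p r \<le> isbell_dist X p q + isbell_dist X q r"
    using pqr by (simp add: isbell_dist_le_iff)
qed

lemma isbell_dist_separated:
  assumes p: "p \<in> isbell X d" and q: "q \<in> isbell X d"
    and "isbell_dist X p q = 0" "isbell_dist X q p = 0"
  shows "p = q"
proof -
  have "fst p x = fst q x" if "x \<in> X" for x
    using isbell_dist_le_iff[OF p q, of 0] isbell_dist_le_iff[OF q p, of 0] assms that
    by (simp add: antisym)
  moreover have "fst p \<in> extensional X" "fst q \<in> extensional X"
    using p q by (auto simp: isbell_def presheaves_def)
  ultimately have "fst p = fst q"
    by (intro extensionalityI) auto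
  with p q show ?thesis
    by (metis isbell_L_fst prod.expand)
qed

section \<open>Weighted limits in the Isbell completion\<close>

text \<open>
  The limit is written as a value of \<open>R\<close>, so that it is an Isbell point; the fact \<open>R_h\<close> of the proof
  recovers the pointwise supremum of presheaf components that the metric forces.
\<close>

lemma (in gen_metric_space) isbell_weighted_limit:
  assumes J: "J \<in> D \<rightarrow> isbell X d"
  shows "\<exists>l. weighted_limit (isbell X d) (isbell_dist X) D J W l"
proof -
  define h where "h y = (INF e\<in>D. snd (J e) y + W e)" for y
  define l where "l = (isbell_R X d h, isbell_L X d (isbell_R X d h))"
  have l: "l \<in> isbell X d"
    unfolding l_def by (rule isbell_point_of_R)
  have R_h: "isbell_R X d h x = (SUP e\<in>D. fst (J e) x -\<^sub>t W e)" if x: "x \<in> X" for x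
  proof -
    have "isbell_R X d h x = (SUP y\<in>X. SUP e\<in>D. d x y -\<^sub>t snd (J e) y -\<^sub>t W e)"
      using x by (simp add: isbell_R_def h_def tsub_INF tsub_tsub)
    also have "\<dots> = (SUP e\<in>D. SUP y\<in>X. d x y -\<^sub>t snd (J e) y -\<^sub>t W e)"
      by (rule SUP_commute)
    also have "\<dots> = (SUP e\<in>D. isbell_R X d (snd (J e)) x -\<^sub>t W e)"
      using x by (simp add: isbell_R_def SUP_tsub)
    also have "\<dots> = (SUP e\<in>D. fst (J e) x -\<^sub>t W e)"
      using J by (intro SUP_cong refl) (simp add: isbell_R_snd[OF Pi_mem[OF J]])
    finally show ?thesis .
  qed
  have "isbell_dist X z l = (SUP e\<in>D. isbell_dist X z (J e) -\<^sub>t W e)" if z: "z \<in> isbell X d" for z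
  proof (rule ennreal_eqI)
    fix c
    have "isbell_dist X z l \<le> c \<longleftrightarrow> (\<forall>x\<in>X. isbell_R X d h x \<le> fst z x + c)"
      using isbell_dist_le_iff[OF z l, of c] by (simp add: l_def)
    also have "\<dots> \<longleftrightarrow> (\<forall>x\<in>X. \<forall>e\<in>D. fst (J e) x \<le> fst z x + (W e + c))"
      by (simp add: R_h SUP_le_iff tsub_le_iff ac_simps)
    also have "\<dots> \<longleftrightarrow> (\<forall>e\<in>D. isbell_dist X z (J e) \<le> W e + c)"
      using J isbell_dist_le_iff[OF z] by blast
    also have "\<dots> \<longleftrightarrow> (SUP e\<in>D. isbell_dist X z (J e) -\<^sub>t W e) \<le> c"
      by (simp add: SUP_le_iff tsub_le_iff)
    finally show "isbell_dist X z l \<le> c \<longleftrightarrow> (SUP e\<in>D. isbell_dist X z (J e) -\<^sub>t W e) \<le> c" .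
  qed
  with l show ?thesis
    unfolding weighted_limit_def by blast
qed

lemma (in gen_metric_space) categorically_complete_isbell:
  "categorically_complete TYPE('e) (isbell X d) (isbell_dist X)"
  unfolding categorically_complete_def
proof (intro conjI allI impI)
  show "gen_metric_space (isbell X d) (isbell_dist X)"
    by (rule gen_metric_space_isbell)
next
  fix D :: "'e set" and dD J W
  assume "short_map D dD (isbell X d) (isbell_dist X) J"
  then show "\<exists>l. weighted_limit (isbell X d) (isbell_dist X) D J W l"
    by (intro isbell_weighted_limit) (simp add: short_map_def)
qed

section \<open>Separated complete spaces are metric semi-tropical modules\<close>

text \<open>
  On a discrete indexing space all distances between distinct points are infinite, so every diagram
  and every weight is short.
\<close>

lemma categorically_complete_discrete_limit:
  fixes D :: "'e set"
  assumes complete: "categorically_complete TYPE('e) Z dZ" and J: "J \<in> D \<rightarrow> Z"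
  shows "\<exists>l. weighted_limit Z dZ D J W l"
proof -
  define disc :: "'e \<Rightarrow> 'e \<Rightarrow> ennreal" where "disc x y = (if x = y then 0 else \<infinity>)" for x y
  interpret gen_metric_space Z dZ
    using complete by (simp add: categorically_complete_def)
  have "gen_metric_space D disc"
    by unfold_locales (auto simp: disc_def)
  moreover have "short_map D disc Z dZ J"
    using J by (auto simp: short_map_def disc_def intro!: dist_self)
  moreover have "short_map D disc UNIV ennreal_dist W"
    by (auto simp: short_map_def disc_def ennreal_dist_def tsub_def)
  ultimately show ?thesis
    using complete unfolding categorically_complete_def by blast
qed

text \<open>
  By separation the representable functions \<open>z \<mapsto> d z y\<close> distinguish points.  Therefore operations
  that these functions turn into the operations of \<open>([0,\<infinity>], max)\<close> inherit all module laws.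
\<close>

lemma (in gen_metric_space) metric_semitropical_moduleI:
  fixes plus :: "'a \<Rightarrow> 'a \<Rightarrow> 'a" and zero :: 'a and act :: "ennreal \<Rightarrow> 'a \<Rightarrow> 'a"
  assumes separated: "\<And>x y. \<lbrakk>x \<in> X; y \<in> X; d x y = 0; d y x = 0\<rbrakk> \<Longrightarrow> x = y"
    and plus_closed: "\<And>x y. \<lbrakk>x \<in> X; y \<in> X\<rbrakk> \<Longrightarrow> plus x y \<in> X"
    and zero_closed: "zero \<in> X"
    and act_closed: "\<And>r x. x \<in> X \<Longrightarrow> act r x \<in> X"
    and d_plus: "\<And>z x y. \<lbrakk>z \<in> X; x \<in> X; y \<in> X\<rbrakk> \<Longrightarrow> d z (plus x y) = max (d z x) (d z y)"
    and d_zero: "\<And>z. z \<in> X \<Longrightarrow> d z zero = 0"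
    and d_act: "\<And>z r x. \<lbrakk>z \<in> X; x \<in> X\<rbrakk> \<Longrightarrow> d z (act r x) = d z x -\<^sub>t r"
  shows "metric_semitropical_module \<lparr>carrier = X, mult = plus, one = zero\<rparr> act d"
proof -
  let ?M = "\<lparr>carrier = X, mult = plus, one = zero\<rparr>"
  note [simp] = plus_closed zero_closed act_closed d_plus d_zero d_act
  have yoneda: "x = y" if "x \<in> X" "y \<in> X" "\<And>z. z \<in> X \<Longrightarrow> d z x = d z y" for x y
    using separated[of x y] that dist_self by metis
  interpret comm_monoid ?M
    by (rule comm_monoidI) (auto intro!: yoneda simp: ac_simps)
  interpret Max: semitropical_module max_monoid max_act
    by (rule semitropical_module_max)
  show ?thesis
  proof
    fix r s m
    show "monoid_endo ?M (act r)"
      by (auto simp: monoid_endo_def hom_def tsub_max intro!: yoneda) (simp add: tsub_def)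
    assume m: "m \<in> carrier ?M"
    show "act (min r s) m = act r m \<otimes>\<^bsub>?M\<^esub> act s m"
      using m Max.act_min[of _ r s] by (auto simp: max_monoid_def max_act_def intro!: yoneda)
    show "act \<infinity> m = \<one>\<^bsub>?M\<^esub>"
      using m Max.act_top by (auto simp: max_monoid_def max_act_def intro!: yoneda)
    show "act (r + s) m = act r (act s m)"
      using m Max.act_plus[of _ r s] by (auto simp: max_monoid_def max_act_def intro!: yoneda)
    show "act 0 m = m"
      using m by (auto simp: tsub_0 intro!: yoneda)
  next
    fix x assume "x \<in> carrier ?M"
    then show "semitropical_hom ?M act max_monoid max_act (d x)"
      by (auto simp: semitropical_hom_def hom_def max_monoid_def max_act_def)
  qed (auto simp: dist_self triangle)
qed

text \<open>
  Two-point indexing spaces suffice: the sum is the limit of a pair with weight \<open>0\<close>, the scalar \<open>r\<close>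
  acts by the limit of a single point with weight \<open>r\<close>, and the zero is the limit of the empty diagram.
\<close>

lemma separated_complete_metric_semitropical_module:
  fixes Z :: "'z set"
  assumes complete: "categorically_complete TYPE(bool) Z dZ"
    and separated: "\<And>x y. \<lbrakk>x \<in> Z; y \<in> Z; dZ x y = 0; dZ y x = 0\<rbrakk> \<Longrightarrow> x = y"
  shows "\<exists>(M :: 'z monoid) act. carrier M = Z \<and> metric_semitropical_module M act dZ"
proof -
  interpret gen_metric_space Z dZ
    using complete by (simp add: categorically_complete_def)
  note limit = categorically_complete_discrete_limit[OF complete, unfolded weighted_limit_def]
  have "\<exists>l. l \<in> Z \<and> (\<forall>z\<in>Z. dZ z l = max (dZ z x) (dZ z y))" if "x \<in> Z" "y \<in> Z" for x y
    using limit[of "\<lambda>b. if b then x else y" UNIV "\<lambda>_. 0"] that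
    by (simp add: UNIV_bool tsub_0 sup_max max.commute)
  then obtain plus where plus: "\<And>x y. \<lbrakk>x \<in> Z; y \<in> Z\<rbrakk> \<Longrightarrow>
      plus x y \<in> Z \<and> (\<forall>z\<in>Z. dZ z (plus x y) = max (dZ z x) (dZ z y))"
    by metis
  obtain zero where zero: "zero \<in> Z" "\<And>z. z \<in> Z \<Longrightarrow> dZ z zero = 0"
    using limit[of undefined "{}" undefined] by (auto simp: bot_ennreal)
  define act where "act r x = (SOME l. l \<in> Z \<and> (\<forall>z\<in>Z. dZ z l = dZ z x -\<^sub>t r))" for r x
  have act: "act r x \<in> Z \<and> (\<forall>z\<in>Z. dZ z (act r x) = dZ z x -\<^sub>t r)" if "x \<in> Z" for r x
  proof -
    have "\<exists>l. l \<in> Z \<and> (\<forall>z\<in>Z. dZ z l = dZ z x -\<^sub>t r)"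
      using limit[of "\<lambda>_. x" "{True}" "\<lambda>_. r"] that by simp
    then show ?thesis
      unfolding act_def by (rule someI_ex)
  qed
  have "metric_semitropical_module \<lparr>carrier = Z, mult = plus, one = zero\<rparr> act dZ"
    using plus zero act separated by (intro metric_semitropical_moduleI) auto
  then show ?thesis
    by (intro exI[of _ "\<lparr>carrier = Z, mult = plus, one = zero\<rparr>"] exI[of _ act]) simp
qed

theorem corollary20:
  fixes X :: "'a set" and d :: "'a \<Rightarrow> 'a \<Rightarrow> ennreal"
  assumes "gen_metric_space X d"
  shows "categorically_complete TYPE('e) (isbell X d) (isbell_dist X) \<and>
    (\<exists>(M :: (('a \<Rightarrow> ennreal) \<times> ('a \<Rightarrow> ennreal)) monoid) act.
      carrier M = isbell X d \<and> metric_semitropical_module M act (isbell_dist X))"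
proof
  interpret gen_metric_space X d
    by (rule assms)
  show "categorically_complete TYPE('e) (isbell X d) (isbell_dist X)"
    by (rule categorically_complete_isbell)
  show "\<exists>(M :: (('a \<Rightarrow> ennreal) \<times> ('a \<Rightarrow> ennreal)) monoid) act.
      carrier M = isbell X d \<and> metric_semitropical_module M act (isbell_dist X)"
    by (rule separated_complete_metric_semitropical_module[OF categorically_complete_isbell
          isbell_dist_separated])
qed

end
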